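(* Let $\Gamma=(V,E)$ be a connected (finite) graph with Betti number $b(\Gamma)=1+\#E-\#V$. Let $m:V\cup E\to\mathbb Z_{>0}$ be a coloring of the vertices and edges of $\Gamma$ by positive integers such that $m(v)\mid m(e)$ for each edge $e\in E$ incident to a vertex $v\in V$. In the case when $\Gamma$ is a tree, assume further that the greatest common divisor of the numbers $m(e)$ ($e\in E$), $m(v)$ ($v\in V$) is $1$. Then $$(q-1)\,\frac{\prod_{e\in E}(q^{m(e)}-1)}{\prod_{v\in V}(q^{m(v)}-1)}\in(q-1)^{b(\Gamma)}\,\mathbb Z[q].$$
   Context: $q$ is an indeterminate. Graphs are finite and non-empty; multiple edges and loops are allowed. *)

theory Defs
  imports "HOL-Library.Uprod" "HOL-Computational_Algebra.Polynomial_Factorial"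
begin

(* Undirected multigraphs: every edge has an unordered pair of ends. Distinct edges may have the
   same ends, and a loop at v is an edge with ends Upair v v. *)

record ('v, 'e) multigraph =
  verts :: "'v set"
  edges :: "'e set"
  ends :: "'e \<Rightarrow> 'v uprod"

definition finite_graph :: "('v, 'e) multigraph \<Rightarrow> bool" where
  "finite_graph \<Gamma> \<longleftrightarrow>
     finite (verts \<Gamma>) \<and> verts \<Gamma> \<noteq> {} \<and> finite (edges \<Gamma>) \<and>
     (\<forall>e\<in>edges \<Gamma>. set_uprod (ends \<Gamma> e) \<subseteq> verts \<Gamma>)"

definition incident :: "('v, 'e) multigraph \<Rightarrow> 'e \<Rightarrow> 'v \<Rightarrow> bool" where
  "incident \<Gamma> e v \<longleftrightarrow> v \<in> set_uprod (ends \<Gamma> e)"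

(* A walk is given by its starting vertex, the list of steps (edge traversed, vertex reached) and
   its final vertex. *)

fun walk :: "('v, 'e) multigraph \<Rightarrow> 'v \<Rightarrow> ('e \<times> 'v) list \<Rightarrow> 'v \<Rightarrow> bool" where
  "walk \<Gamma> u [] v \<longleftrightarrow> u \<in> verts \<Gamma> \<and> u = v"
| "walk \<Gamma> u ((e, w) # p) v \<longleftrightarrow>
     u \<in> verts \<Gamma> \<and> e \<in> edges \<Gamma> \<and> ends \<Gamma> e = Upair u w \<and> walk \<Gamma> w p v"

definition connected_graph :: "('v, 'e) multigraph \<Rightarrow> bool" where
  "connected_graph \<Gamma> \<longleftrightarrow>
     finite_graph \<Gamma> \<and> (\<forall>u\<in>verts \<Gamma>. \<forall>v\<in>verts \<Gamma>. \<exists>p. walk \<Gamma> u p v)"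

(* A loop is a cycle of length 1 and a pair of parallel edges gives a cycle of length 2;
   distinctness of the edges excludes going back and forth along a single edge. *)

definition cycle :: "('v, 'e) multigraph \<Rightarrow> 'v \<Rightarrow> ('e \<times> 'v) list \<Rightarrow> bool" where
  "cycle \<Gamma> u p \<longleftrightarrow>
     walk \<Gamma> u p u \<and> p \<noteq> [] \<and> distinct (map fst p) \<and> distinct (map snd p)"

definition tree :: "('v, 'e) multigraph \<Rightarrow> bool" where
  "tree \<Gamma> \<longleftrightarrow> connected_graph \<Gamma> \<and> (\<nexists>u p. cycle \<Gamma> u p)"

definition betti :: "('v, 'e) multigraph \<Rightarrow> int" where
  "betti \<Gamma> = 1 + int (card (edges \<Gamma>)) - int (card (verts \<Gamma>))"

(* The indeterminate q in the field of fractions of Z[q], and the subring Z[q] of that field. *)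

definition qvar :: "int poly fract" where
  "qvar = to_fract [:0, 1:]"

definition Zq :: "int poly fract set" where
  "Zq = range to_fract"

end

theory Submission
  imports Defs
begin

text \<open>
  A minimal-length walk towards a root \<open>r\<close> assigns to each vertex \<open>v \<noteq> r\<close> its own edge \<open>e\<close> at \<open>v\<close>, and
  \<open>q^m(v) - 1\<close> divides \<open>q^m(e) - 1\<close>. If the graph has a cycle, take \<open>r\<close> on it and delete an edge of
  the cycle at \<open>r\<close>: the graph stays connected, and the deleted edge can be assigned to \<open>r\<close> itself.
  In a tree, the factor \<open>q^m(r) - 1\<close> is left over in the denominator; but \<open>r\<close> is arbitrary, and the
  ideal generated by all \<open>q^m(r) - 1\<close> contains \<open>q^g - 1\<close> for \<open>g = gcd(m(r)) = 1\<close>.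
\<close>

section \<open>Divisibility among the elements \<open>x ^ n - 1\<close>\<close>

lemma power_minus_one_dvd:
  fixes x :: "'a::comm_ring_1"
  assumes "a dvd b"
  shows "x ^ a - 1 dvd x ^ b - 1"
proof -
  obtain k where "b = a * k"
    using assms by blast
  then have "x ^ b - 1 = (x ^ a - 1) * (\<Sum>i<k. (x ^ a) ^ i)"
    by (simp add: power_mult power_diff_1_eq)
  then show ?thesis
    by simp
qed

text \<open>Euclid's algorithm on the exponents. The factor \<open>N\<close> is carried along
  because for a tree each root only yields a divisibility of the edge product times
  \<open>x ^ m (Inl r) - 1\<close>.\<close>

lemma dvd_mult_power_gcd_minus_one:
  fixes x c N :: "'a::comm_ring_1"
  assumes "c dvd N * (x ^ a - 1)" "c dvd N * (x ^ b - 1)"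
  shows "c dvd N * (x ^ gcd a b - 1)"
  using assms
proof (induction a b rule: gcd_nat_induct)
  case (base a)
  then show ?case by simp
next
  case (step a b)
  have "x ^ a = x ^ (a mod b) * x ^ (b * (a div b))"
    by (simp flip: power_add)
  then have eq: "N * (x ^ (a mod b) - 1)
      = N * (x ^ a - 1) - x ^ (a mod b) * (N * (x ^ (b * (a div b)) - 1))"
    by (simp add: algebra_simps)
  have "N * (x ^ b - 1) dvd N * (x ^ (b * (a div b)) - 1)"
    by (intro mult_dvd_mono power_minus_one_dvd) auto
  then have "c dvd N * (x ^ (b * (a div b)) - 1)"
    by (rule dvd_trans[OF step.prems(2)])
  with step.prems(1) have "c dvd N * (x ^ (a mod b) - 1)"
    unfolding eq by (rule dvd_diff[OF _ dvd_mult])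
  with step show ?case
    by (metis gcd_red_nat)
qed

lemma dvd_mult_power_Gcd_minus_one:
  fixes x c N :: "'a::comm_ring_1"
  assumes "finite S" "\<And>a. a \<in> S \<Longrightarrow> c dvd N * (x ^ a - 1)"
  shows "c dvd N * (x ^ Gcd S - 1)"
  using assms
proof (induction S rule: finite_induct)
  case empty
  \<comment> \<open>\<open>Gcd {} = 0\<close>, so the right-hand side is
    \<open>N * 0\<close>.\<close>
  then show ?case by simp
next
  case (insert a S)
  then show ?case
    by (simp add: dvd_mult_power_gcd_minus_one)
qed

lemma prod_power_minus_one_dvd:
  fixes x :: "'a::comm_ring_1"
  assumes "finite E" "finite W" "inj_on f W" "f ` W \<subseteq> E"
    and "\<And>v. v \<in> W \<Longrightarrow> k v dvd n (f v)"
  shows "(\<Prod>v\<in>W. x ^ k v - 1) * (x - 1) ^ (card E - card W) dvd (\<Prod>e\<in>E. x ^ n e - 1)"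
proof -
  have "(\<Prod>v\<in>W. x ^ k v - 1) dvd (\<Prod>v\<in>W. x ^ n (f v) - 1)"
    by (intro prod_dvd_prod power_minus_one_dvd assms)
  also have "(\<Prod>v\<in>W. x ^ n (f v) - 1) = (\<Prod>e\<in>f ` W. x ^ n e - 1)"
    by (simp add: prod.reindex assms)
  finally have 1: "(\<Prod>v\<in>W. x ^ k v - 1) dvd (\<Prod>e\<in>f ` W. x ^ n e - 1)" .
  have "(\<Prod>e\<in>E - f ` W. x - 1) dvd (\<Prod>e\<in>E - f ` W. x ^ n e - 1)"
    using power_minus_one_dvd[of 1 _ x] by (intro prod_dvd_prod) auto
  moreover have "card (E - f ` W) = card E - card W"
    using assms by (simp add: card_Diff_subset card_image)
  ultimately have 2: "(x - 1) ^ (card E - card W) dvd (\<Prod>e\<in>E - f ` W. x ^ n e - 1)"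
    by simp
  have "(\<Prod>e\<in>E. x ^ n e - 1) = (\<Prod>e\<in>f ` W. x ^ n e - 1) * (\<Prod>e\<in>E - f ` W. x ^ n e - 1)"
    using assms by (simp add: prod.subset_diff mult.commute)
  then show ?thesis
    using mult_dvd_mono[OF 1 2] by simp
qed

section \<open>Assigning distinct incident edges to vertices\<close>

text \<open>The first edge of a shortest walk to \<open>r\<close> within \<open>A\<close> leads to a
  strictly closer vertex, so it cannot be chosen from both of its ends. The set \<open>A\<close>
  allows for the deletion of an edge.\<close>

lemma exists_parent_edges:
  assumes walks: "\<And>v. v \<in> verts \<Gamma> \<Longrightarrow> \<exists>p. walk \<Gamma> v p r \<and> fst ` set p \<subseteq> A"
  shows "\<exists>f. inj_on f (verts \<Gamma> - {r}) \<and>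
    (\<forall>v\<in>verts \<Gamma> - {r}. f v \<in> A \<inter> edges \<Gamma> \<and> incident \<Gamma> (f v) v)"
proof -
  define d where "d v = (LEAST n. \<exists>p. walk \<Gamma> v p r \<and> fst ` set p \<subseteq> A \<and> length p = n)" for v
  have "\<exists>e w. e \<in> A \<inter> edges \<Gamma> \<and> ends \<Gamma> e = Upair v w \<and> d w < d v"
    if v: "v \<in> verts \<Gamma> - {r}" for v
  proof -
    have "\<exists>n p. walk \<Gamma> v p r \<and> fst ` set p \<subseteq> A \<and> length p = n"
      using walks[of v] v by blast
    then have "\<exists>p. walk \<Gamma> v p r \<and> fst ` set p \<subseteq> A \<and> length p = d v"
      unfolding d_def by (rule LeastI_ex)
    then obtain p where p: "walk \<Gamma> v p r" "fst ` set p \<subseteq> A" "length p = d v"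
      by blast
    with v obtain e w p' where p': "p = (e, w) # p'"
      by (cases p) auto
    \<comment> \<open>The tail \<open>p'\<close> competes in the minimum that defines
      \<open>d w\<close>.\<close>
    have "d w \<le> length p'"
      unfolding d_def using p p' by (intro Least_le) auto
    then have "d w < d v"
      using p(3) p' by simp
    with p p' show ?thesis
      by (intro exI[of _ e] exI[of _ w]) auto
  qed
  then obtain f g where fg: "\<And>v. v \<in> verts \<Gamma> - {r} \<Longrightarrow>
      f v \<in> A \<inter> edges \<Gamma> \<and> ends \<Gamma> (f v) = Upair v (g v) \<and> d (g v) < d v"
    by metis
  have "inj_on f (verts \<Gamma> - {r})"
  proof (rule inj_onI)
    fix v w assume "v \<in> verts \<Gamma> - {r}" "w \<in> verts \<Gamma> - {r}" "f v = f w"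
    with fg[of v] fg[of w] have "Upair v (g v) = Upair w (g w)" "d (g v) < d v" "d (g w) < d w"
      by auto
    \<comment> \<open>Otherwise \<open>g v = w\<close> and \<open>g w = v\<close>, whence
      \<open>d w < d v < d w\<close>.\<close>
    then show "v = w"
      by auto
  qed
  with fg show ?thesis
    by (intro exI[of _ f]) (auto simp: incident_def)
qed

text \<open>Follow the given walk until it is about to traverse \<open>e\<close>: it is then at
  \<open>u\<close>, where it may stop, or at \<open>w\<close>, where the detour \<open>p\<close>
  takes over.\<close>

lemma walk_avoiding_edge:
  assumes "ends \<Gamma> e = Upair u w" "walk \<Gamma> w p u" "e \<notin> fst ` set p" "walk \<Gamma> v p' u"
  shows "\<exists>p''. walk \<Gamma> v p'' u \<and> e \<notin> fst ` set p''"
  using assms(4)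
proof (induction p' arbitrary: v)
  case Nil
  then show ?case
    by (intro exI[of _ "[]"]) auto
next
  case (Cons s p')
  obtain e' x where s: "s = (e', x)"
    by fastforce
  with Cons.prems have step: "v \<in> verts \<Gamma>" "e' \<in> edges \<Gamma>" "ends \<Gamma> e' = Upair v x" "walk \<Gamma> x p' u"
    by auto
  show ?case
  proof (cases "e' = e")
    case True
    with step assms(1) consider "v = u" | "v = w"
      by auto
    then show ?thesis
    proof cases
      case 1
      with step show ?thesis
        by (intro exI[of _ "[]"]) auto
    next
      case 2
      with assms show ?thesis by blast
    qed
  next
    case False
    obtain p'' where "walk \<Gamma> x p'' u" "e \<notin> fst ` set p''"
      using Cons.IH step by blast
    with False step show ?thesis
      by (intro exI[of _ "(e', x) # p''"]) auto
  qed
qed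

lemma exists_incident_edges_if_cycle:
  assumes conn: "connected_graph \<Gamma>" and "cycle \<Gamma> u p"
  shows "\<exists>f. inj_on f (verts \<Gamma>) \<and> (\<forall>v\<in>verts \<Gamma>. f v \<in> edges \<Gamma> \<and> incident \<Gamma> (f v) v)"
proof -
  \<comment> \<open>The deleted edge is the first one of the cycle. The rest of the cycle leads from
    \<open>w\<close> back to \<open>u\<close> and avoids \<open>e\<close>, as the edges of a cycle
    are distinct; a loop is the case \<open>w = u\<close>.\<close>
  obtain e w p' where p: "p = (e, w) # p'"
    using assms(2) by (cases p) (auto simp: cycle_def)
  with assms(2) have e: "u \<in> verts \<Gamma>" "e \<in> edges \<Gamma>" "ends \<Gamma> e = Upair u w" "walk \<Gamma> w p' u"
    "e \<notin> fst ` set p'"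
    by (auto simp: cycle_def)
  have "\<exists>p. walk \<Gamma> v p u \<and> fst ` set p \<subseteq> - {e}" if "v \<in> verts \<Gamma>" for v
    using conn that e walk_avoiding_edge[OF e(3-5)] unfolding connected_graph_def by blast
  then obtain f where f: "inj_on f (verts \<Gamma> - {u})"
    "\<And>v. v \<in> verts \<Gamma> - {u} \<Longrightarrow> f v \<in> - {e} \<inter> edges \<Gamma> \<and> incident \<Gamma> (f v) v"
    using exists_parent_edges[of \<Gamma> u "- {e}"] by metis
  have "inj_on (f(u := e)) (verts \<Gamma>)"
    using f by (fastforce simp: inj_on_def)
  moreover have "\<forall>v\<in>verts \<Gamma>. (f(u := e)) v \<in> edges \<Gamma> \<and> incident \<Gamma> ((f(u := e)) v) v"
    using f e by (auto simp: incident_def)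
  ultimately show ?thesis
    by blast
qed

section \<open>The divisibility with denominators cleared\<close>

text \<open>The inequality ensures that the truncated difference in the exponent is the Betti
  number.\<close>

lemma prod_edges_divisible:
  fixes x :: "'a::comm_ring_1" and \<Gamma> :: "('v, 'e) multigraph" and m :: "'v + 'e \<Rightarrow> nat"
  assumes conn: "connected_graph \<Gamma>"
    and dvd: "\<forall>e \<in> edges \<Gamma>. \<forall>v \<in> verts \<Gamma>. incident \<Gamma> e v \<longrightarrow> m (Inl v) dvd m (Inr e)"
    and gcd: "tree \<Gamma> \<longrightarrow> Gcd (m ` (verts \<Gamma> <+> edges \<Gamma>)) = 1"
  shows "card (verts \<Gamma>) \<le> Suc (card (edges \<Gamma>)) \<and>
    (\<Prod>v\<in>verts \<Gamma>. x ^ m (Inl v) - 1) * (x - 1) ^ (Suc (card (edges \<Gamma>)) - card (verts \<Gamma>))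
      dvd (\<Prod>e\<in>edges \<Gamma>. x ^ m (Inr e) - 1) * (x - 1)"
proof (cases "tree \<Gamma>")
  case False
  have fin: "finite (verts \<Gamma>)" "finite (edges \<Gamma>)"
    using conn by (auto simp: connected_graph_def finite_graph_def)
  obtain u p where "cycle \<Gamma> u p"
    using False conn by (auto simp: tree_def)
  from exists_incident_edges_if_cycle[OF conn this]
  obtain f where f: "inj_on f (verts \<Gamma>)" "\<And>v. v \<in> verts \<Gamma> \<Longrightarrow> f v \<in> edges \<Gamma> \<and> incident \<Gamma> (f v) v"
    by blast
  have card: "card (verts \<Gamma>) \<le> card (edges \<Gamma>)"
    using f fin by (intro card_inj_on_le[of f]) auto
  have "(\<Prod>v\<in>verts \<Gamma>. x ^ m (Inl v) - 1) * (x - 1) ^ (card (edges \<Gamma>) - card (verts \<Gamma>))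
      dvd (\<Prod>e\<in>edges \<Gamma>. x ^ m (Inr e) - 1)"
    using f fin dvd by (intro prod_power_minus_one_dvd[of _ _ f]) auto
  \<comment> \<open>The extra factor \<open>x - 1\<close> raises the exponent by one to the Betti
    number.\<close>
  from mult_dvd_mono[OF this dvd_refl[of "x - 1"]] card show ?thesis
    by (simp add: Suc_diff_le mult_ac)
next
  case True
  have fin: "finite (verts \<Gamma>)" "finite (edges \<Gamma>)" and "verts \<Gamma> \<noteq> {}"
    using conn by (auto simp: connected_graph_def finite_graph_def)
  let ?b = "Suc (card (edges \<Gamma>)) - card (verts \<Gamma>)"
  let ?N = "\<Prod>e\<in>edges \<Gamma>. x ^ m (Inr e) - 1"
  have root: "card (verts \<Gamma>) \<le> Suc (card (edges \<Gamma>)) \<and>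
      (\<Prod>v\<in>verts \<Gamma>. x ^ m (Inl v) - 1) * (x - 1) ^ ?b dvd ?N * (x ^ m (Inl r) - 1)"
    if r: "r \<in> verts \<Gamma>" for r
  proof -
    have "\<exists>p. walk \<Gamma> v p r \<and> fst ` set p \<subseteq> UNIV" if "v \<in> verts \<Gamma>" for v
      using conn that r unfolding connected_graph_def by blast
    then obtain f where f: "inj_on f (verts \<Gamma> - {r})"
      "\<And>v. v \<in> verts \<Gamma> - {r} \<Longrightarrow> f v \<in> edges \<Gamma> \<and> incident \<Gamma> (f v) v"
      using exists_parent_edges[of \<Gamma> r UNIV] by auto
    have pos: "card (verts \<Gamma>) > 0"
      using r fin card_gt_0_iff by blast
    have card: "card (verts \<Gamma> - {r}) = card (verts \<Gamma>) - 1"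
      using r by simp
    have le: "card (verts \<Gamma> - {r}) \<le> card (edges \<Gamma>)"
      using f fin by (intro card_inj_on_le[of f]) auto
    \<comment> \<open>Leaving out \<open>r\<close> already gives the full exponent, so the second
      factor on the right only has to supply the vertex factor of \<open>r\<close>.\<close>
    have b: "card (edges \<Gamma>) - card (verts \<Gamma> - {r}) = ?b"
      using card pos by simp
    have "(\<Prod>v\<in>verts \<Gamma> - {r}. x ^ m (Inl v) - 1)
        * (x - 1) ^ (card (edges \<Gamma>) - card (verts \<Gamma> - {r})) dvd ?N"
      using f fin dvd by (intro prod_power_minus_one_dvd[of _ _ f]) auto
    from mult_dvd_mono[OF this dvd_refl[of "x ^ m (Inl r) - 1"]] show ?thesis
      using le card pos fin r b by (simp add: prod.remove[of _ r] mult_ac)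
  qed
  \<comment> \<open>Roots range over vertices only. This loses nothing, since the color of an edge
    is a multiple of the color of either end.\<close>
  have "Gcd ((\<lambda>v. m (Inl v)) ` verts \<Gamma>) dvd Gcd (m ` (verts \<Gamma> <+> edges \<Gamma>))"
  proof (rule Gcd_greatest)
    fix k assume "k \<in> m ` (verts \<Gamma> <+> edges \<Gamma>)"
    then consider v where "v \<in> verts \<Gamma>" "k = m (Inl v)" | e where "e \<in> edges \<Gamma>" "k = m (Inr e)"
      by auto
    then show "Gcd ((\<lambda>v. m (Inl v)) ` verts \<Gamma>) dvd k"
    proof cases
      case 1
      then show ?thesis by (simp add: Gcd_dvd)
    next
      case 2
      obtain v w where "ends \<Gamma> e = Upair v w"
        by (meson uprod_exhaust)
      with 2 conn have "v \<in> verts \<Gamma>" "incident \<Gamma> e v"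
        by (force simp: connected_graph_def finite_graph_def incident_def)+
      with 2 dvd have "m (Inl v) dvd k"
        by blast
      moreover have "Gcd ((\<lambda>v. m (Inl v)) ` verts \<Gamma>) dvd m (Inl v)"
        using \<open>v \<in> verts \<Gamma>\<close> by (simp add: Gcd_dvd)
      ultimately show ?thesis
        by (rule dvd_trans[rotated])
    qed
  qed
  with gcd True have "Gcd ((\<lambda>v. m (Inl v)) ` verts \<Gamma>) = 1"
    by simp
  moreover have "(\<Prod>v\<in>verts \<Gamma>. x ^ m (Inl v) - 1) * (x - 1) ^ ?b
      dvd ?N * (x ^ Gcd ((\<lambda>v. m (Inl v)) ` verts \<Gamma>) - 1)"
    using root fin by (intro dvd_mult_power_Gcd_minus_one) auto
  ultimately show ?thesis
    using root \<open>verts \<Gamma> \<noteq> {}\<close> by auto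
qed

section \<open>Passage to the field of fractions\<close>

lemma to_fract_power: "to_fract (a ^ n) = to_fract a ^ n"
  by (induction n) simp_all

lemma to_fract_prod: "to_fract (\<Prod>i\<in>A. f i) = (\<Prod>i\<in>A. to_fract (f i))"
  by (induction A rule: infinite_finite_induct) simp_all

lemma qvar_power_minus_one: "qvar ^ n - 1 = to_fract ([:0, 1:] ^ n - 1)"
  by (simp add: qvar_def to_fract_power)

lemma qvar_power_minus_one_neq_0:
  assumes "n > 0"
  shows "qvar ^ n - 1 \<noteq> 0"
proof
  assume "qvar ^ n - 1 = 0"
  then have "[:0, 1:] ^ n - (1 :: int poly) = 0"
    unfolding qvar_power_minus_one by (simp only: to_fract_eq_0_iff)
  then have "degree ([:0, 1:] ^ n :: int poly) = 0"
    by simp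
  with assms show False
    by (simp add: degree_power_eq)
qed

theorem mainTheorem10:
  fixes \<Gamma> :: "('v, 'e) multigraph"
    and m :: "'v + 'e \<Rightarrow> nat"
  assumes "connected_graph \<Gamma>"
    and "\<forall>x \<in> verts \<Gamma> <+> edges \<Gamma>. m x > 0"
    and "\<forall>e \<in> edges \<Gamma>. \<forall>v \<in> verts \<Gamma>. incident \<Gamma> e v \<longrightarrow> m (Inl v) dvd m (Inr e)"
    and "tree \<Gamma> \<longrightarrow> Gcd (m ` (verts \<Gamma> <+> edges \<Gamma>)) = 1"
  shows "(qvar - 1) * ((\<Prod>e\<in>edges \<Gamma>. qvar ^ m (Inr e) - 1) / (\<Prod>v\<in>verts \<Gamma>. qvar ^ m (Inl v) - 1))
           \<in> {(qvar - 1) powi betti \<Gamma> * f | f. f \<in> Zq}"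
proof -
  let ?X = "[:0, 1:] :: int poly"
  define b where "b = Suc (card (edges \<Gamma>)) - card (verts \<Gamma>)"
  define N where "N = (\<Prod>e\<in>edges \<Gamma>. ?X ^ m (Inr e) - 1)"
  define D where "D = (\<Prod>v\<in>verts \<Gamma>. ?X ^ m (Inl v) - 1)"
  \<comment> \<open>Divisibility is applied in Z[q], as it says nothing about integrality in the
    fraction field; the cofactor \<open>h\<close> is thus a polynomial.\<close>
  have "card (verts \<Gamma>) \<le> Suc (card (edges \<Gamma>))" and "D * (?X - 1) ^ b dvd N * (?X - 1)"
    using prod_edges_divisible[OF assms(1,3,4), of ?X] by (auto simp: b_def N_def D_def)
  then obtain h where h: "N * (?X - 1) = D * (?X - 1) ^ b * h" and b: "betti \<Gamma> = int b"
    unfolding b_def betti_def by fastforce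
  have N: "(\<Prod>e\<in>edges \<Gamma>. qvar ^ m (Inr e) - 1) = to_fract N"
    and D: "(\<Prod>v\<in>verts \<Gamma>. qvar ^ m (Inl v) - 1) = to_fract D"
    by (simp_all add: N_def D_def to_fract_prod qvar_power_minus_one del: to_fract_diff)
  have q: "to_fract (?X - 1) = qvar - 1"
    using qvar_power_minus_one[of 1] by simp
  \<comment> \<open>Positivity of the vertex colors makes every factor of the denominator
    nonzero.\<close>
  have "to_fract D \<noteq> 0"
    unfolding D[symmetric] using assms(1,2) qvar_power_minus_one_neq_0
    by (auto simp: connected_graph_def finite_graph_def)
  moreover have "to_fract N * (qvar - 1) = to_fract D * (qvar - 1) ^ b * to_fract h"
    using arg_cong[OF h, of to_fract] by (simp add: to_fract_power q del: to_fract_diff)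
  ultimately have "(qvar - 1) * (to_fract N / to_fract D) = (qvar - 1) powi betti \<Gamma> * to_fract h"
    by (simp add: b field_simps)
  then show ?thesis
    unfolding N D Zq_def by blast
qed

end
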